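(* For every $n\in\mathbb{N}$ the following relations hold in $U$: $$[xyy(xxyy)^n,x]_q=(q-q^{-3})\left(xyy(xxyy)^nx-(xxyy)^{n+1}\right),$$ $$[x,yxx(yyxx)^n]_q=0,$$ $$[x,x(yyxx)^n]_q=(q^3-q^{-1})(xxyy)^nxx,$$ $$[y(xxyy)^n,x]_q=(q-q^{-3})y(xxyy)^nx.$$
   Context: Let $\mathbb{F}$ be a field of characteristic zero and let $q\in\mathbb{F}$ be nonzero and not a root of unity; $\mathbb{N}=\{0,1,2,\ldots\}$. Let $\mathbb{V}$ be the free associative unital $\mathbb{F}$-algebra on two noncommuting generators (letters) $x,y$; the words in $x,y$ (including the trivial word $\mathbf{1}$) form a basis of $\mathbb{V}$. Words such as $(xxyy)^nx$ are written with respect to the free (concatenation) product. The $q$-shuffle product $\star$ on the vector space $\mathbb{V}$ is the bilinear associative product with unit $\mathbf{1}$ determined as follows. Put $\langle x,x\rangle=\langle y,y\rangle=2$ and $\langle x,y\rangle=\langle y,x\rangle=-2$. For nontrivial words $u=u_1\cdots u_r$ and $v=v_1\cdots v_s$, $$u\star v=u_1\big((u_2\cdots u_r)\star v\big)+v_1\big(u\star(v_2\cdots v_s)\big)q^{\langle v_1,u_1\rangle+\cdots+\langle v_1,u_r\rangle}.$$ $U$ denotes the subalgebra of $(\mathbb{V},\star)$ generated by $x,y$; all the words in the statement lie in $U$. The $q$-commutator is taken with respect to $\star$: $[X,Y]_q=qX\star Y-q^{-1}Y\star X$. *)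

theory Defs
  imports Complex_Main "HOL-Library.Poly_Mapping"
begin

datatype letter = X | Y

text \<open>
  Words form the free monoid on the letters. Written additively, concatenation makes
  the finitely supported functions on words into the free associative unital algebra:
  the ring multiplication of \<^typ>\<open>letter list \<Rightarrow>\<^sub>0 'a\<close> is the convolution product, hence
  the bilinear extension of concatenation, and its unit is the trivial word.
\<close>

instantiation list :: (type) monoid_add
begin

definition zero_list :: "'a list" where "0 = []"

definition plus_list :: "'a list \<Rightarrow> 'a list \<Rightarrow> 'a list" where "u + v = u @ v"

instance
  by standard (simp_all add: zero_list_def plus_list_def)

end

type_synonym 'a falg = "letter list \<Rightarrow>\<^sub>0 'a"

definition word :: "letter list \<Rightarrow> 'a::field_char_0 falg" where
  "word w = Poly_Mapping.single w 1"

definition gen_x :: "'a::field_char_0 falg"  ("\<x>") where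
  "\<x> = word [X]"

definition gen_y :: "'a::field_char_0 falg"  ("\<y>") where
  "\<y> = word [Y]"

definition scale :: "'a::field_char_0 \<Rightarrow> 'a falg \<Rightarrow> 'a falg"  (infixr "*\<^sub>F" 75) where
  "c *\<^sub>F f = Poly_Mapping.single 0 c * f"

definition pairing :: "letter \<Rightarrow> letter \<Rightarrow> int" where
  "pairing a b = (if a = b then 2 else - 2)"

fun qshuffle_words :: "'a::field_char_0 \<Rightarrow> letter list \<Rightarrow> letter list \<Rightarrow> 'a falg" where
  "qshuffle_words q [] v = word v"
| "qshuffle_words q u [] = word u"
| "qshuffle_words q (a # u) (b # v) =
     word [a] * qshuffle_words q u (b # v)
     + (q powi (\<Sum>c\<leftarrow>a # u. pairing b c)) *\<^sub>F (word [b] * qshuffle_words q (a # u) v)"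

definition qshuffle :: "'a::field_char_0 falg \<Rightarrow> 'a \<Rightarrow> 'a falg \<Rightarrow> 'a falg"
    ("(_ \<star>\<^bsub>_\<^esub> _)" [71, 0, 71] 70) where
  "f \<star>\<^bsub>q\<^esub> g =
     (\<Sum>u\<in>Poly_Mapping.keys f. \<Sum>v\<in>Poly_Mapping.keys g.
        (Poly_Mapping.lookup f u * Poly_Mapping.lookup g v) *\<^sub>F qshuffle_words q u v)"

definition qcomm :: "'a::field_char_0 \<Rightarrow> 'a falg \<Rightarrow> 'a falg \<Rightarrow> 'a falg" where
  "qcomm q P Q = q *\<^sub>F (P \<star>\<^bsub>q\<^esub> Q) - (q powi (- 1)) *\<^sub>F (Q \<star>\<^bsub>q\<^esub> P)"

lemma lookup_scale: "Poly_Mapping.lookup (c *\<^sub>F f) w = c * Poly_Mapping.lookup f w"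
proof -
  have "c *\<^sub>F f = Poly_Mapping.map ((*) c) f"
    unfolding scale_def by (simp add: mult_map_scale_conv_mult)
  then show ?thesis by (simp add: map.rep_eq when_def)
qed

lemma word_mult: "word u * word v = word (u @ v)"
  by (simp add: word_def mult_single plus_list_def)

lemma word_Nil: "word [] = 1"
  by (simp add: word_def zero_list_def[symmetric])

lemma qshuffle_word: "word u \<star>\<^bsub>q\<^esub> word v = qshuffle_words q u v"
  by (simp add: qshuffle_def word_def scale_def)

end

theory Submission
  imports Defs
begin

text \<open>
  Since one factor is the single letter \<^term>\<open>X\<close>, both \<open>x \<star> w\<close> and \<open>w \<star> x\<close> are sums over the
  insertions of \<^term>\<open>X\<close> into \<open>w\<close>, so a combination \<open>a (x \<star> w) + b (w \<star> x)\<close> can be computed letter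
  by letter: reading a letter \<open>c\<close> multiplies \<open>a\<close> by \<open>q\<close> to the power \<open>\<langle>c,x\<rangle>\<close> and leaves \<open>b\<close> alone.
  The blocks \<open>xxyy\<close> and \<open>yyxx\<close> are neutral for the pairing. For \<open>(a, b)\<close> proportional to
  \<open>(-q\<^sup>-\<^sup>3, q)\<close> the insertions inside a block \<open>xxyy\<close> cancel; for \<open>(q\<^sup>3, -q\<^sup>-\<^sup>1)\<close> those
  inside consecutive blocks \<open>yyxx\<close> telescope. Each prefix occurring in the theorem turns the
  coefficients of the \<open>q\<close>-commutator into one of these two pairs.
\<close>

lemma scale_add_right: "c *\<^sub>F (f + g) = c *\<^sub>F f + c *\<^sub>F g"
  by (simp add: scale_def distrib_left)

lemma scale_add_left: "(c + d) *\<^sub>F f = c *\<^sub>F f + d *\<^sub>F f"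
  by (simp add: scale_def single_add distrib_right)

lemma scale_scale: "c *\<^sub>F (d *\<^sub>F f) = (c * d) *\<^sub>F f"
  by (simp add: scale_def mult_single flip: mult.assoc)

lemma scale_zero_left [simp]: "0 *\<^sub>F f = 0"
  by (simp add: scale_def)

lemma scale_minus_left: "(- c) *\<^sub>F f = - (c *\<^sub>F f)"
  by (simp add: scale_def single_uminus)

lemma scale_diff_right: "c *\<^sub>F (f - g) = c *\<^sub>F f - c *\<^sub>F g"
  by (simp add: scale_def algebra_simps)

lemma scale_diff_left: "(c - d) *\<^sub>F f = c *\<^sub>F f - d *\<^sub>F f"
  by (simp add: scale_def algebra_simps single_diff)

lemma word_mult_scale: "word w * (c *\<^sub>F f) = c *\<^sub>F (word w * f)"
proof -
  have "word w * Poly_Mapping.single 0 c = Poly_Mapping.single 0 c * word w"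
    by (simp add: word_def mult_single)
  then show ?thesis
    by (simp add: scale_def flip: mult.assoc)
qed

lemma word_power: "word u ^ n = word (concat (replicate n u))"
  by (induction n) (simp_all add: word_Nil word_mult)

lemma append_concat_replicate_shift:
  "u @ concat (replicate n (v @ u)) = concat (replicate n (u @ v)) @ u"
  by (induction n) simp_all

definition weight :: "letter list \<Rightarrow> int" where
  "weight w = (\<Sum>c\<leftarrow>w. pairing X c)"

lemma weight_simps [simp]:
  "weight [] = 0"
  "weight (X # w) = weight w + 2"
  "weight (Y # w) = weight w - 2"
  by (simp_all add: weight_def pairing_def)

lemma weight_append: "weight (u @ v) = weight u + weight v"
  by (simp add: weight_def)

lemma weight_concat_replicate: "weight (concat (replicate n u)) = int n * weight u"
  by (induction n) (simp_all add: weight_append algebra_simps)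

definition insert_comb :: "'a::field_char_0 \<Rightarrow> 'a \<Rightarrow> 'a \<Rightarrow> letter list \<Rightarrow> 'a falg" where
  "insert_comb q a b w = a *\<^sub>F qshuffle_words q [X] w + b *\<^sub>F qshuffle_words q w [X]"

lemma insert_comb_Nil: "insert_comb q a b [] = (a + b) *\<^sub>F word [X]"
  by (simp add: insert_comb_def scale_add_left)

text \<open>In the first product \<open>X\<close> comes first for free or lets \<open>c\<close> pass
  at the cost \<open>q powi pairing c X\<close>; in the second it comes first only by crossing all
  of \<open>c # w\<close>.\<close>

lemma insert_comb_Cons:
  "insert_comb q a b (c # w) =
     (a + b * q powi weight (c # w)) *\<^sub>F word (X # c # w)
     + word [c] * insert_comb q (a * q powi pairing c X) b w"
proof -
  have "qshuffle_words q [X] (c # w) =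
      word (X # c # w) + q powi pairing c X *\<^sub>F (word [c] * qshuffle_words q [X] w)"
    by (simp add: word_mult)
  moreover have "qshuffle_words q (c # w) [X] =
      q powi weight (c # w) *\<^sub>F word (X # c # w) + word [c] * qshuffle_words q w [X]"
    by (simp add: word_mult weight_def add.commute)
  ultimately show ?thesis
    by (simp add: insert_comb_def scale_add_right scale_add_left scale_scale word_mult_scale
        distrib_left add_ac)
qed

lemma insert_comb_letter_Cons:
  "insert_comb q a b (X # w) =
     (a + b * q powi (weight w + 2)) *\<^sub>F word (X # X # w) + word [X] * insert_comb q (a * q ^ 2) b w"
  "insert_comb q a b (Y # w) =
     (a + b * q powi (weight w - 2)) *\<^sub>F word (X # Y # w)
     + word [Y] * insert_comb q (a * inverse (q ^ 2)) b w"
  by (simp_all add: insert_comb_Cons pairing_def power_int_minus)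

lemmas expand_insertions =
  insert_comb_letter_Cons distrib_left word_mult_scale word_mult power_int_minus
  add.assoc[symmetric] mult.assoc[symmetric] scale_add_left[symmetric]

lemma qcomm_word_x: "qcomm q (word w) \<x> = insert_comb q (- inverse q) q w"
  by (simp add: qcomm_def insert_comb_def gen_x_def qshuffle_word scale_minus_left power_int_minus)

lemma qcomm_x_word: "qcomm q \<x> (word w) = insert_comb q q (- inverse q) w"
  by (simp add: qcomm_def insert_comb_def gen_x_def qshuffle_word scale_minus_left power_int_minus)

lemma mult_inverse_cancel: "q \<noteq> 0 \<Longrightarrow> q * (inverse q * z) = z" for q z :: "'a::field"
  by simp

text \<open>A separate second pass: \<open>algebra_simps\<close> nests to the right, as
  \<open>mult_inverse_cancel\<close> needs, against the flipped associativity in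
  \<open>expand_insertions\<close>.\<close>

lemmas cancel_powers =
  eval_nat_numeral mult_inverse_cancel scale_diff_right algebra_simps

text \<open>Inserting \<open>X\<close> before the block or after its second letter gives the same
  word with opposite coefficients; after the first or third letter the coefficient is zero. The
  block has weight zero, so the pair reappears at \<open>w\<close>.\<close>

lemma insert_comb_XXYY:
  assumes "q \<noteq> 0" "weight w = 0"
  shows "insert_comb q (- inverse (q ^ 3)) q ([X, X, Y, Y] @ w) =
    word [X, X, Y, Y] * insert_comb q (- inverse (q ^ 3)) q w"
  using assms by (simp add: expand_insertions) (simp add: cancel_powers)

text \<open>Again the places after the first and third letters contribute zero. The place after the
  second gives the word that also arises by inserting \<open>X\<close> right before
  \<open>w\<close>, hence the telescoping.\<close>

lemma insert_comb_YYXX: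
  assumes "q \<noteq> 0" "weight w = 0"
  shows "insert_comb q (q ^ 3) (- inverse q) ([Y, Y, X, X] @ w) =
    (q ^ 3 - inverse q) *\<^sub>F (word (X # [Y, Y, X, X] @ w) - word ([Y, Y, X, X] @ X # w)) +
    word [Y, Y, X, X] * insert_comb q (q ^ 3) (- inverse q) w"
  using assms by (simp add: expand_insertions) (simp add: cancel_powers scale_diff_left)

text \<open>Only the place after the first letter of the prefix survives. The prefix has weight -2,
  which turns \<open>- inverse q\<close> into \<open>- inverse (q ^ 3)\<close>.\<close>

lemma insert_comb_XYY:
  assumes "q \<noteq> 0" "weight w = 0"
  shows "insert_comb q (- inverse q) q ([X, Y, Y] @ w) =
    (inverse (q ^ 3) - q) *\<^sub>F word ([X, X, Y, Y] @ w) +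
    word [X, Y, Y] * insert_comb q (- inverse (q ^ 3)) q w"
  using assms by (simp add: expand_insertions) (simp add: cancel_powers)

lemma insert_comb_YXX:
  assumes "q \<noteq> 0" "weight w = 0"
  shows "insert_comb q q (- inverse q) ([Y, X, X] @ w) =
    (inverse q - q ^ 3) *\<^sub>F word ([Y, X, X, X] @ w) +
    word [Y, X, X] * insert_comb q (q ^ 3) (- inverse q) w"
  using assms by (simp add: expand_insertions) (simp add: cancel_powers)

lemma insert_comb_X:
  assumes "q \<noteq> 0" "weight w = 0"
  shows "insert_comb q q (- inverse q) (X # w) = word [X] * insert_comb q (q ^ 3) (- inverse q) w"
  using assms by (simp add: expand_insertions) (simp add: cancel_powers)

lemma insert_comb_Y:
  assumes "q \<noteq> 0" "weight w = 0"
  shows "insert_comb q (- inverse q) q (Y # w) = word [Y] * insert_comb q (- inverse (q ^ 3)) q w"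
  using assms by (simp add: expand_insertions) (simp add: cancel_powers)

lemma insert_comb_XXYY_power:
  assumes "q \<noteq> 0"
  shows "insert_comb q (- inverse (q ^ 3)) q (concat (replicate n [X, X, Y, Y])) =
    (q - inverse (q ^ 3)) *\<^sub>F word (concat (replicate n [X, X, Y, Y]) @ [X])"
proof (induction n)
  case 0
  then show ?case by (simp add: insert_comb_Nil)
next
  case (Suc n)
  then show ?case
    using insert_comb_XXYY[OF assms, of "concat (replicate n [X, X, Y, Y])"]
    by (simp add: weight_concat_replicate word_mult_scale word_mult)
qed

lemma insert_comb_YYXX_power:
  assumes "q \<noteq> 0"
  shows "insert_comb q (q ^ 3) (- inverse q) (concat (replicate n [Y, Y, X, X])) =
    (q ^ 3 - inverse q) *\<^sub>F word (X # concat (replicate n [Y, Y, X, X]))"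
proof (induction n)
  case 0
  then show ?case by (simp add: insert_comb_Nil)
next
  case (Suc n)
  then show ?case
    using insert_comb_YYXX[OF assms, of "concat (replicate n [Y, Y, X, X])"]
    by (simp add: weight_concat_replicate word_mult_scale word_mult scale_diff_right)
qed

theorem proposition4p3:
  fixes q :: "'a::field_char_0" and n :: nat
  assumes "q \<noteq> 0"
    and "\<And>m::nat. m > 0 \<Longrightarrow> q ^ m \<noteq> 1"
  shows "qcomm q (\<x> * \<y> * \<y> * (\<x> * \<x> * \<y> * \<y>) ^ n) \<x>
           = (q - q powi (- 3)) *\<^sub>F
               (\<x> * \<y> * \<y> * (\<x> * \<x> * \<y> * \<y>) ^ n * \<x> - (\<x> * \<x> * \<y> * \<y>) ^ (n + 1))
       \<and> qcomm q \<x> (\<y> * \<x> * \<x> * (\<y> * \<y> * \<x> * \<x>) ^ n) = 0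
       \<and> qcomm q \<x> (\<x> * (\<y> * \<y> * \<x> * \<x>) ^ n)
           = (q ^ 3 - q powi (- 1)) *\<^sub>F ((\<x> * \<x> * \<y> * \<y>) ^ n * \<x> * \<x>)
       \<and> qcomm q (\<y> * (\<x> * \<x> * \<y> * \<y>) ^ n) \<x>
           = (q - q powi (- 3)) *\<^sub>F (\<y> * (\<x> * \<x> * \<y> * \<y>) ^ n * \<x>)"
proof -
  note q = \<open>q \<noteq> 0\<close>
  define u where "u = concat (replicate n [X, X, Y, Y])"
  define v where "v = concat (replicate n [Y, Y, X, X])"
  have weight_u: "weight u = 0" and weight_v: "weight v = 0"
    by (simp_all add: u_def v_def weight_concat_replicate)
  have xxyy: "(\<x> * \<x> * \<y> * \<y>) ^ n = word u" and yyxx: "(\<y> * \<y> * \<x> * \<x>) ^ n = word v"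
    by (simp_all add: u_def v_def gen_x_def gen_y_def word_mult word_power)
  note insert_comb_u = insert_comb_XXYY_power[OF q, of n, folded u_def]
  note insert_comb_v = insert_comb_YYXX_power[OF q, of n, folded v_def]
  have "qcomm q (word ([X, Y, Y] @ u)) \<x> =
      (q - inverse (q ^ 3)) *\<^sub>F (word ([X, Y, Y] @ u @ [X]) - word ([X, X, Y, Y] @ u))"
    unfolding qcomm_word_x insert_comb_XYY[OF q weight_u] insert_comb_u
    by (simp add: word_mult_scale word_mult scale_diff_right scale_diff_left right_diff_distrib)
  \<comment> \<open>The term surviving in the prefix cancels the single term left by
    \<open>v\<close>.\<close>
  moreover have "qcomm q \<x> (word ([Y, X, X] @ v)) = 0"
    unfolding qcomm_x_word insert_comb_YXX[OF q weight_v] insert_comb_v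
    by (simp add: word_mult_scale word_mult scale_diff_left right_diff_distrib)
  moreover have "qcomm q \<x> (word (X # v)) = (q ^ 3 - inverse q) *\<^sub>F word (u @ [X, X])"
    unfolding qcomm_x_word insert_comb_X[OF q weight_v] insert_comb_v
    \<comment> \<open>The insertion yields \<open>[X, X] @ v\<close>; shifting the period rewrites
      it as \<open>u @ [X, X]\<close>.\<close>
    using append_concat_replicate_shift[of "[X, X]" n "[Y, Y]"]
    by (simp add: u_def v_def word_mult_scale word_mult)
  moreover have "qcomm q (word (Y # u)) \<x> = (q - inverse (q ^ 3)) *\<^sub>F word (Y # u @ [X])"
    unfolding qcomm_word_x insert_comb_Y[OF q weight_u] insert_comb_u
    by (simp add: word_mult_scale word_mult)
  ultimately show ?thesis
    by (simp add: xxyy yyxx power_int_minus) (simp add: gen_x_def gen_y_def word_mult)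
qed

end
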